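(* Let $\mathcal{C}$ be a non-empty class of labelled graphs that is closed under isomorphism and under taking induced subgraphs, let $\mathcal{C}_n$ be the set of members of $\mathcal{C}$ with vertex set $\{1,\ldots,n\}$, and let $n\ge 1$. Fix an isomorphism-invariant preorder $\preceq$ on labelled graphs and a function $m$ assigning to each labelled graph $H$ a subset $m(H)\subseteq V(H)$. Then: (a) If $m$ satisfies (A) and (B) for all graphs $H$, then the call $\texttt{generate}(K_1,n)$ outputs exactly one member of each isomorphism class of $\mathcal{C}_n$. (b) Suppose $m$ satisfies (A) and (B) for all $H$ with $|V(H)|<n$, and satisfies (A$'$) for all $H$ with $|V(H)|=n$. Let $G_1,G_2$ be non-isomorphic members of $\mathcal{C}_n$ with the same reduced deck. Then the call $\texttt{generate}(K_1,n)$ outputs $G_1$ and $G_2$ (up to isomorphism) as children of the same non-empty set of parents.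
   Context: All graphs are simple and undirected; a labelled graph on $n$ vertices has vertex set $\{1,\ldots,n\}$. For $\phi\in S_n$ and a graph $G$ on $\{1,\ldots,n\}$, $G^\phi$ is the graph with an edge $i^\phi j^\phi$ for each edge $ij$ of $G$; $\operatorname{Aut}(G)=\{\phi\in S_n : G^\phi=G\}$ (literal equality). For a vertex $v$, the card $G-v$ is the unlabelled graph obtained by deleting $v$; the reduced deck of $G$ is the set (not multiset) of isomorphism types of its cards. For $W\subseteq V(G)$, $G[W]v$ denotes the graph obtained from $G$ by adding a new vertex $v$ (labelled $|V(G)|+1$) adjacent exactly to the vertices in $W$. Properties of $m$: (A) for each $H$, $m(H)$ is an orbit of $\operatorname{Aut}(H)$ on $V(H)$; (A$'$) for each $H$, $m(H)$ is the union of all orbits of $\operatorname{Aut}(H)$ consisting of vertices $v$ such that the card $H-v$ is maximal under $\preceq$ among all cards of $H$; (B) for each $H$ on $\{1,\ldots,n\}$ and each $\phi\in S_n$, $m(H^\phi)=m(H)^\phi$. Algorithm $\texttt{generate}(G,n)$: if $|V(G)|=n$, output $G$; otherwise, for each orbit $A$ of the action of $\operatorname{Aut}(G)$ on the set of subsets of $V(G)$, choose any $W\in A$, form $H:=G[W]v$, and if $H\in\mathcal{C}$ and $v\in m(H)$, call $\texttt{generate}(H,n)$. When $H=G[W]v$ is formed in this loop, $G$ is called a parent of $H$ and $H$ a child of $G$. *)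

theory Defs
  imports "HOL-Combinatorics.Permutations" "HOL-Library.Multiset"
begin

section \<open>Simple undirected graphs\<close>

datatype sgraph = SGraph (verts: "nat set") (edges: "nat set set")

definition simple_graph :: "sgraph \<Rightarrow> bool" where
  "simple_graph G \<longleftrightarrow> finite (verts G) \<and> (\<forall>e\<in>edges G. e \<subseteq> verts G \<and> card e = 2)"

definition lgraphs :: "nat \<Rightarrow> sgraph set" where
  "lgraphs k = {G. simple_graph G \<and> verts G = {1..k}}"

text \<open>The graph without vertices belongs to \<^term>\<open>lgraphs 0\<close> and hence to \<^term>\<open>labelled\<close>;
  it is needed only as the card of \<open>K1\<close>.\<close>

definition labelled :: "sgraph set" where
  "labelled = (\<Union>k. lgraphs k)"

definition isomorphic :: "sgraph \<Rightarrow> sgraph \<Rightarrow> bool" where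
  "isomorphic G H \<longleftrightarrow> (\<exists>f. bij_betw f (verts G) (verts H) \<and> edges H = (\<lambda>e. f ` e) ` edges G)"

definition induced :: "sgraph \<Rightarrow> nat set \<Rightarrow> sgraph" where
  "induced G W = SGraph W {e \<in> edges G. e \<subseteq> W}"

definition K1 :: sgraph where
  "K1 = SGraph {1} {}"

section \<open>Relabelling, automorphisms and orbits\<close>

definition relabel :: "(nat \<Rightarrow> nat) \<Rightarrow> sgraph \<Rightarrow> sgraph" where
  "relabel \<phi> G = SGraph (\<phi> ` verts G) ((\<lambda>e. \<phi> ` e) ` edges G)"

definition Aut :: "sgraph \<Rightarrow> (nat \<Rightarrow> nat) set" where
  "Aut G = {\<phi>. \<phi> permutes verts G \<and> relabel \<phi> G = G}"

definition vertex_orbits :: "sgraph \<Rightarrow> nat set set" where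
  "vertex_orbits G = (\<lambda>v. {\<phi> v | \<phi>. \<phi> \<in> Aut G}) ` verts G"

definition subset_orbits :: "sgraph \<Rightarrow> nat set set set" where
  "subset_orbits G = (\<lambda>W. {\<phi> ` W | \<phi>. \<phi> \<in> Aut G}) ` Pow (verts G)"

section \<open>Unlabelled graphs, cards and reduced decks\<close>

text \<open>An unlabelled graph is represented by the set of all its labelled versions.\<close>

definition unlabelled :: "sgraph \<Rightarrow> sgraph set" where
  "unlabelled G = {H \<in> labelled. isomorphic G H}"

definition deck_card :: "sgraph \<Rightarrow> nat \<Rightarrow> sgraph set" where
  "deck_card G v = unlabelled (induced G (verts G - {v}))"

definition reduced_deck :: "sgraph \<Rightarrow> sgraph set set" where
  "reduced_deck G = deck_card G ` verts G"

definition iso_invariant_preorder :: "sgraph rel \<Rightarrow> bool" where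
  "iso_invariant_preorder le \<longleftrightarrow> preorder_on labelled le \<and>
     (\<forall>G\<in>labelled. \<forall>H\<in>labelled. \<forall>G'\<in>labelled. \<forall>H'\<in>labelled.
        isomorphic G G' \<longrightarrow> isomorphic H H' \<longrightarrow> (G, H) \<in> le \<longrightarrow> (G', H') \<in> le)"

text \<open>For an isomorphism-invariant preorder the choice of representatives is immaterial.\<close>

definition unlabelled_le :: "sgraph rel \<Rightarrow> sgraph set \<Rightarrow> sgraph set \<Rightarrow> bool" where
  "unlabelled_le le c d \<longleftrightarrow> (\<exists>X\<in>c. \<exists>Y\<in>d. (X, Y) \<in> le)"

definition maximal_card :: "sgraph rel \<Rightarrow> sgraph \<Rightarrow> nat \<Rightarrow> bool" where
  "maximal_card le H v \<longleftrightarrow>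
     (\<forall>c\<in>reduced_deck H. unlabelled_le le (deck_card H v) c \<longrightarrow> unlabelled_le le c (deck_card H v))"

section \<open>Classes of graphs and the conditions on m\<close>

text \<open>Members of a class have at least one vertex. Since members are labelled by \<open>{1..k}\<close>,
  closure under induced subgraphs refers to the labelled versions of the induced subgraph.\<close>

definition hereditary_class :: "sgraph set \<Rightarrow> bool" where
  "hereditary_class C \<longleftrightarrow>
     C \<noteq> {} \<and> C \<subseteq> (\<Union>k\<in>{1..}. lgraphs k) \<and>
     (\<forall>G\<in>C. \<forall>H\<in>labelled. isomorphic G H \<longrightarrow> H \<in> C) \<and>
     (\<forall>G\<in>C. \<forall>W. W \<subseteq> verts G \<longrightarrow> W \<noteq> {} \<longrightarrow> unlabelled (induced G W) \<subseteq> C)"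

definition cond_A :: "(sgraph \<Rightarrow> nat set) \<Rightarrow> sgraph \<Rightarrow> bool" where
  "cond_A m H \<longleftrightarrow> m H \<in> vertex_orbits H"

definition cond_A' :: "sgraph rel \<Rightarrow> (sgraph \<Rightarrow> nat set) \<Rightarrow> sgraph \<Rightarrow> bool" where
  "cond_A' le m H \<longleftrightarrow> m H = \<Union>{A \<in> vertex_orbits H. \<forall>v\<in>A. maximal_card le H v}"

definition cond_B :: "(sgraph \<Rightarrow> nat set) \<Rightarrow> sgraph \<Rightarrow> bool" where
  "cond_B m H \<longleftrightarrow> (\<forall>\<phi>. \<phi> permutes verts H \<longrightarrow> m (relabel \<phi> H) = \<phi> ` m H)"

section \<open>The generation algorithm\<close>

definition new_vertex :: "sgraph \<Rightarrow> nat" where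
  "new_vertex G = card (verts G) + 1"

definition add_vertex :: "sgraph \<Rightarrow> nat set \<Rightarrow> sgraph" where
  "add_vertex G W =
     SGraph (insert (new_vertex G) (verts G)) (edges G \<union> {{w, new_vertex G} | w. w \<in> W})"

definition accepted :: "sgraph set \<Rightarrow> (sgraph \<Rightarrow> nat set) \<Rightarrow> sgraph \<Rightarrow> nat set \<Rightarrow> bool" where
  "accepted C m G W \<longleftrightarrow> add_vertex G W \<in> C \<and> new_vertex G \<in> m (add_vertex G W)"

text \<open>Big-step semantics: \<open>generate C m n p G out\<close> says that some terminating run of the
  call \<open>generate(G,n)\<close>, made from within the call for \<open>p\<close> (\<open>None\<close> for the initial call),
  produces the multiset \<open>out\<close> of outputs. Each output is logged as a pair of its parent and the
  graph itself. The function \<open>W\<close> records the arbitrary choices made in the loop over the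
  orbits \<open>A\<close>.\<close>

inductive generate ::
  "sgraph set \<Rightarrow> (sgraph \<Rightarrow> nat set) \<Rightarrow> nat \<Rightarrow> sgraph option \<Rightarrow> sgraph \<Rightarrow>
     (sgraph option \<times> sgraph) multiset \<Rightarrow> bool"
  for C m n where
  emit: "card (verts G) = n \<Longrightarrow> generate C m n p G {#(p, G)#}"
| loop: "\<lbrakk>card (verts G) \<noteq> n;
     \<And>A. A \<in> subset_orbits G \<Longrightarrow> W A \<in> A;
     \<And>A. \<lbrakk>A \<in> subset_orbits G; accepted C m G (W A)\<rbrakk>
        \<Longrightarrow> generate C m n (Some G) (add_vertex G (W A)) (out A);
     \<And>A. \<lbrakk>A \<in> subset_orbits G; \<not> accepted C m G (W A)\<rbrakk> \<Longrightarrow> out A = {#}\<rbrakk>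
     \<Longrightarrow> generate C m n p G (\<Sum>A\<in>subset_orbits G. out A)"

definition output_parents :: "(sgraph option \<times> sgraph) multiset \<Rightarrow> sgraph \<Rightarrow> sgraph set" where
  "output_parents out X = {P. \<exists>H. (Some P, H) \<in># out \<and> isomorphic H X}"

end

theory Submission
  imports Defs
begin

text \<open>Call the cards \<open>X - v\<close> with \<open>v \<in> m(X)\<close> the selected cards of \<open>X\<close>. Since \<open>m\<close> commutes with
  isomorphisms, a call for \<open>G\<close> makes a recursive call for a copy of \<open>X\<close> iff \<open>G\<close> is a selected card
  of \<open>X\<close>: an isomorphism \<open>X - v \<rightarrow> G\<close> extends to one from \<open>X\<close> onto some \<open>G[W]v\<close>, and replacing
  \<open>W\<close> by another member of its orbit does not change the isomorphism type. Under (A), \<open>X\<close> has a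
  single selected card up to isomorphism, and an isomorphism \<open>G[W]v \<rightarrow> G[W']v\<close> between accepted
  children can be corrected to fix \<open>v\<close>, so that \<open>W\<close> and \<open>W'\<close> lie in the same orbit and the
  copy of \<open>X\<close> is produced only once. This gives (a) by following selected cards down to \<open>K1\<close>.
  Under (A') the selected cards of \<open>X\<close> are the maximal elements of its reduced deck, and the
  parents of \<open>X\<close> are the graphs on \<open>n - 1\<close> vertices, generated once each by (a), that represent
  them.\<close>

section \<open>Isomorphisms as explicit maps\<close>

text \<open>Makes the bijection hidden in \<open>isomorphic\<close> explicit, since the arguments
  below must know where individual vertices, above all the newly added one, are sent.\<close>

definition graph_iso :: "(nat \<Rightarrow> nat) \<Rightarrow> sgraph \<Rightarrow> sgraph \<Rightarrow> bool" where
  "graph_iso f G H \<longleftrightarrow> bij_betw f (verts G) (verts H) \<and> edges H = (\<lambda>e. f ` e) ` edges G"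

abbreviation delete_vertex :: "sgraph \<Rightarrow> nat \<Rightarrow> sgraph" where
  "delete_vertex G v \<equiv> induced G (verts G - {v})"

lemma isomorphic_iff_graph_iso: "isomorphic G H \<longleftrightarrow> (\<exists>f. graph_iso f G H)"
  by (simp add: isomorphic_def graph_iso_def)

lemma simple_graph_edges: "simple_graph G \<Longrightarrow> e \<in> edges G \<Longrightarrow> e \<subseteq> verts G"
  by (simp add: simple_graph_def)

lemma lgraphs_simple: "G \<in> lgraphs k \<Longrightarrow> simple_graph G"
  and lgraphs_verts: "G \<in> lgraphs k \<Longrightarrow> verts G = {1..k}"
  by (auto simp: lgraphs_def)

lemma lgraphs_card: "G \<in> lgraphs k \<Longrightarrow> card (verts G) = k"
  using lgraphs_verts[of G k] by simp

lemma lgraphs_labelled: "G \<in> lgraphs k \<Longrightarrow> G \<in> labelled"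
  by (auto simp: labelled_def)

lemma labelled_lgraphs: "G \<in> labelled \<Longrightarrow> G \<in> lgraphs (card (verts G))"
  unfolding labelled_def using lgraphs_card by blast

lemma graph_iso_id: "graph_iso id G G"
  by (auto simp: graph_iso_def)

lemma graph_iso_comp:
  assumes "graph_iso f G H" "graph_iso g H K"
  shows "graph_iso (g \<circ> f) G K"
  using assms bij_betw_trans[of f "verts G" "verts H" g "verts K"]
  by (simp add: graph_iso_def image_image image_comp)

text \<open>Edges lie inside the vertex set, so values of a map outside it are irrelevant. This
  allows an isomorphism to be replaced by a permutation agreeing with it on the vertices.\<close>

lemma graph_iso_cong:
  assumes "simple_graph G" "\<And>x. x \<in> verts G \<Longrightarrow> f x = g x"
  shows "graph_iso f G H \<longleftrightarrow> graph_iso g G H"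
proof -
  have "f ` e = g ` e" if "e \<in> edges G" for e
    using simple_graph_edges[OF assms(1) that] assms(2) by (auto intro!: image_cong)
  then have "(\<lambda>e. f ` e) ` edges G = (\<lambda>e. g ` e) ` edges G"
    by (auto intro!: image_cong)
  moreover have "bij_betw f (verts G) (verts H) \<longleftrightarrow> bij_betw g (verts G) (verts H)"
    using assms(2) by (rule bij_betw_cong)
  ultimately show ?thesis
    by (simp add: graph_iso_def)
qed

lemma graph_iso_inv_into:
  assumes "simple_graph G" "graph_iso f G H"
  shows "graph_iso (inv_into (verts G) f) H G"
proof -
  have bij: "bij_betw f (verts G) (verts H)" and E: "edges H = (\<lambda>e. f ` e) ` edges G"
    using assms(2) by (auto simp: graph_iso_def)
  have "inv_into (verts G) f ` (f ` e) = e" if "e \<in> edges G" for e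
    using bij simple_graph_edges[OF assms(1) that]
    by (auto simp: bij_betw_def intro!: inv_into_image_cancel)
  then have "edges G = (\<lambda>e. inv_into (verts G) f ` e) ` edges H"
    by (simp add: E image_image)
  with bij show ?thesis
    by (simp add: graph_iso_def bij_betw_inv_into)
qed

lemma graph_iso_simple:
  assumes "simple_graph G" "graph_iso f G H"
  shows "simple_graph H"
proof -
  have bij: "bij_betw f (verts G) (verts H)" and E: "edges H = (\<lambda>e. f ` e) ` edges G"
    using assms(2) by (auto simp: graph_iso_def)
  have "f ` e \<subseteq> verts H \<and> card (f ` e) = 2" if "e \<in> edges G" for e
  proof -
    have "e \<subseteq> verts G" "card e = 2"
      using assms(1) that by (auto simp: simple_graph_def)
    moreover have "inj_on f e"
      using bij \<open>e \<subseteq> verts G\<close> by (auto simp: bij_betw_def intro: inj_on_subset)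
    ultimately show ?thesis
      using bij by (auto simp: bij_betw_def card_image)
  qed
  moreover have "finite (verts H)"
    using assms(1) bij bij_betw_finite by (auto simp: simple_graph_def)
  ultimately show ?thesis
    by (auto simp: simple_graph_def E)
qed

text \<open>Injectivity of \<open>f\<close> on all of \<open>verts G\<close> ensures that an edge of
  \<open>G\<close> whose image lies in the image of \<open>W\<close> already lies in
  \<open>W\<close>, so no extra edges appear.\<close>

lemma graph_iso_induced:
  assumes "simple_graph G" "graph_iso f G H" "W \<subseteq> verts G"
  shows "graph_iso f (induced G W) (induced H (f ` W))"
proof -
  have inj: "inj_on f (verts G)" and E: "edges H = (\<lambda>e. f ` e) ` edges G"
    using assms(2) by (auto simp: graph_iso_def bij_betw_def)
  have "f ` e \<subseteq> f ` W \<longleftrightarrow> e \<subseteq> W" if "e \<in> edges G" for e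
    using simple_graph_edges[OF assms(1) that] assms(3) inj_on_image_mem_iff[OF inj _ assms(3)]
    unfolding image_subset_iff by blast
  then have "{e \<in> edges H. e \<subseteq> f ` W} = (\<lambda>e. f ` e) ` {e \<in> edges G. e \<subseteq> W}"
    unfolding E by auto
  moreover have "bij_betw f W (f ` W)"
    using inj assms(3) by (auto simp: bij_betw_def intro: inj_on_subset)
  ultimately show ?thesis
    by (simp add: graph_iso_def induced_def)
qed

lemma graph_iso_delete_vertex:
  assumes "simple_graph G" "graph_iso f G H" "v \<in> verts G"
  shows "graph_iso f (delete_vertex G v) (delete_vertex H (f v))"
proof -
  have "f ` (verts G - {v}) = verts H - {f v}"
    using assms(2,3) by (auto simp: graph_iso_def bij_betw_def inj_on_def)
  then show ?thesis
    using graph_iso_induced[OF assms(1,2), of "verts G - {v}"] by auto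
qed

section \<open>Isomorphism as an equivalence, and labelled versions\<close>

lemma isomorphic_refl: "isomorphic G G"
  using graph_iso_id isomorphic_iff_graph_iso by blast

lemma isomorphic_sym: "simple_graph G \<Longrightarrow> isomorphic G H \<Longrightarrow> isomorphic H G"
  using graph_iso_inv_into isomorphic_iff_graph_iso by blast

lemma isomorphic_trans: "isomorphic G H \<Longrightarrow> isomorphic H K \<Longrightarrow> isomorphic G K"
  using graph_iso_comp unfolding isomorphic_iff_graph_iso by blast

lemma simple_graph_induced: "simple_graph G \<Longrightarrow> W \<subseteq> verts G \<Longrightarrow> simple_graph (induced G W)"
  by (auto simp: simple_graph_def induced_def finite_subset)

lemma verts_induced [simp]: "verts (induced G W) = W"
  by (simp add: induced_def)

text \<open>Deleting a vertex may leave a gap in the labels, so a card has to be renamed before it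
  can be compared with graphs met by the algorithm.\<close>

lemma simple_graph_labelled_version:
  assumes "simple_graph G"
  shows "\<exists>H\<in>lgraphs (card (verts G)). isomorphic G H"
proof -
  have "finite (verts G)"
    using assms by (simp add: simple_graph_def)
  then obtain f where f: "bij_betw f (verts G) {1..card (verts G)}"
    using finite_same_card_bij[of "verts G" "{1..card (verts G)}"] by auto
  define H where "H = SGraph {1..card (verts G)} ((\<lambda>e. f ` e) ` edges G)"
  have "graph_iso f G H"
    using f by (simp add: graph_iso_def H_def)
  moreover have "simple_graph H"
    using graph_iso_simple[OF assms calculation] .
  ultimately show ?thesis
    using isomorphic_iff_graph_iso by (auto simp: lgraphs_def H_def)
qed

text \<open>The forward direction rests on the class being nonempty: a labelled version of
  \<open>G\<close> belongs to both sets and so links \<open>G\<close> with \<open>H\<close>.\<close>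

lemma unlabelled_eq_iff:
  assumes "simple_graph G" "simple_graph H"
  shows "unlabelled G = unlabelled H \<longleftrightarrow> isomorphic G H"
proof
  assume eq: "unlabelled G = unlabelled H"
  obtain K where K: "K \<in> labelled" "isomorphic G K"
    using simple_graph_labelled_version[OF assms(1)] lgraphs_labelled by blast
  then have "isomorphic H K"
    using eq by (auto simp: unlabelled_def)
  then show "isomorphic G H"
    using K isomorphic_sym[OF assms(2)] isomorphic_trans by blast
next
  assume "isomorphic G H"
  then show "unlabelled G = unlabelled H"
    using isomorphic_sym[OF assms(1)] isomorphic_trans unfolding unlabelled_def by blast
qed

section \<open>Automorphisms and orbits\<close>

lemma Aut_iff_graph_iso: "\<phi> \<in> Aut G \<longleftrightarrow> \<phi> permutes verts G \<and> graph_iso \<phi> G G"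
proof (cases "\<phi> permutes verts G")
  case True
  then have "relabel \<phi> G = G \<longleftrightarrow> edges G = (\<lambda>e. \<phi> ` e) ` edges G"
    unfolding relabel_def by (metis permutes_image sgraph.collapse sgraph.inject)
  with True show ?thesis
    by (simp add: Aut_def graph_iso_def permutes_imp_bij)
qed (simp add: Aut_def)

text \<open>\<open>Aut\<close> and (B) use permutations that fix everything outside the vertex set,
  whereas an isomorphism is arbitrary there. When both vertex sets coincide, resetting it to the
  identity outside bridges the gap.\<close>

lemma graph_iso_extend_permutes:
  assumes "simple_graph G" "graph_iso f G H" "verts H = verts G"
  obtains \<phi> where "\<phi> permutes verts G" "graph_iso \<phi> G H" "\<And>x. x \<in> verts G \<Longrightarrow> \<phi> x = f x"
proof
  let ?\<phi> = "\<lambda>x. if x \<in> verts G then f x else x"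
  have "bij_betw ?\<phi> (verts G) (verts G)"
    using assms(2,3) by (auto simp: graph_iso_def bij_betw_def inj_on_def)
  then show "?\<phi> permutes verts G"
    by (rule bij_imp_permutes) auto
  show "graph_iso ?\<phi> G H"
    using graph_iso_cong[OF assms(1), of ?\<phi> f] assms(2) by simp
qed auto

lemma Aut_id: "id \<in> Aut G"
  by (simp add: Aut_iff_graph_iso graph_iso_id permutes_id)

lemma Aut_comp: "\<phi> \<in> Aut G \<Longrightarrow> \<psi> \<in> Aut G \<Longrightarrow> \<psi> \<circ> \<phi> \<in> Aut G"
  by (auto simp: Aut_iff_graph_iso graph_iso_comp permutes_compose)

lemma Aut_inv:
  assumes "simple_graph G" "\<phi> \<in> Aut G"
  shows "inv \<phi> \<in> Aut G"
proof -
  have p: "\<phi> permutes verts G" and i: "graph_iso \<phi> G G"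
    using assms(2) by (auto simp: Aut_iff_graph_iso)
  have "inv_into (verts G) \<phi> x = inv \<phi> x" if "x \<in> verts G" for x
    using p that
    by (metis inv_into_f_f permutes_image permutes_inj_on permutes_inverses(2) f_inv_into_f)
  then have "graph_iso (inv \<phi>) G G"
    using graph_iso_inv_into[OF assms(1) i] graph_iso_cong[OF assms(1)] by blast
  with p show ?thesis
    by (simp add: Aut_iff_graph_iso permutes_inv)
qed

text \<open>Any member may serve as base point: if \<open>W\<close> is the image of \<open>U\<close>
  under \<open>\<psi>\<close>, then \<open>U\<close> is the image of \<open>W\<close> under
  \<open>inv \<psi>\<close>. The independence of the loop from its choices rests on this.\<close>

lemma subset_orbit_eq:
  assumes "simple_graph G" "A \<in> subset_orbits G" "W \<in> A"
  shows "A = {\<phi> ` W |\<phi>. \<phi> \<in> Aut G}"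
proof -
  obtain U where A: "A = {\<phi> ` U |\<phi>. \<phi> \<in> Aut G}"
    using assms(2) by (auto simp: subset_orbits_def)
  then obtain \<psi> where \<psi>: "\<psi> \<in> Aut G" "W = \<psi> ` U"
    using assms(3) by auto
  have "inj \<psi>"
    using \<psi>(1) permutes_inj by (auto simp: Aut_def)
  then have U: "U = inv \<psi> ` W"
    by (simp add: \<psi>(2) image_comp)
  show ?thesis
  proof (intro equalityI subsetI)
    fix V assume "V \<in> A"
    then obtain \<phi> where "\<phi> \<in> Aut G" "V = (\<phi> \<circ> inv \<psi>) ` W"
      unfolding A U by (auto simp: image_comp)
    then show "V \<in> {\<phi> ` W |\<phi>. \<phi> \<in> Aut G}"
      using Aut_comp[OF Aut_inv[OF assms(1) \<psi>(1)]] by blast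
  next
    fix V assume "V \<in> {\<phi> ` W |\<phi>. \<phi> \<in> Aut G}"
    then obtain \<phi> where "\<phi> \<in> Aut G" "V = (\<phi> \<circ> \<psi>) ` U"
      unfolding \<psi>(2) by (auto simp: image_comp)
    then show "V \<in> A"
      unfolding A using Aut_comp[OF \<psi>(1)] by blast
  qed
qed

lemma subset_orbit_members:
  assumes "A \<in> subset_orbits G" "W \<in> A"
  shows "W \<subseteq> verts G"
proof -
  obtain U \<phi> where "U \<subseteq> verts G" "\<phi> \<in> Aut G" "W = \<phi> ` U"
    using assms by (auto simp: subset_orbits_def)
  then show ?thesis
    using permutes_image by (fastforce simp: Aut_def)
qed

lemma subset_orbit_exists:
  assumes "W \<subseteq> verts G"
  shows "\<exists>A\<in>subset_orbits G. W \<in> A"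
proof -
  have "W = id ` W"
    by simp
  then have "W \<in> {\<phi> ` W |\<phi>. \<phi> \<in> Aut G}"
    using Aut_id[of G] by blast
  then show ?thesis
    by (rule bexI) (use assms in \<open>unfold subset_orbits_def, blast\<close>)
qed

lemma finite_subset_orbits: "simple_graph G \<Longrightarrow> finite (subset_orbits G)"
  by (auto simp: subset_orbits_def simple_graph_def)

lemma subset_orbit_nonempty: "A \<in> subset_orbits G \<Longrightarrow> A \<noteq> {}"
  using Aut_id[of G] unfolding subset_orbits_def by blast

lemma vertex_orbit_transitive:
  assumes "simple_graph G" "A \<in> vertex_orbits G" "u \<in> A" "v \<in> A"
  obtains \<phi> where "\<phi> \<in> Aut G" "\<phi> u = v"
proof -
  obtain w \<alpha> \<beta> where \<alpha>\<beta>: "\<alpha> \<in> Aut G" "\<beta> \<in> Aut G" "u = \<alpha> w" "v = \<beta> w"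
    using assms(2-4) by (auto simp: vertex_orbits_def)
  have "\<beta> (inv \<alpha> u) = v"
    using \<alpha>\<beta> permutes_inverses(2)[of \<alpha> "verts G"] by (simp add: Aut_def)
  then show ?thesis
    using that[of "\<beta> \<circ> inv \<alpha>"] Aut_comp Aut_inv assms(1) \<alpha>\<beta> by simp
qed

lemma vertex_orbit_nonempty: "A \<in> vertex_orbits G \<Longrightarrow> A \<noteq> {}"
  using Aut_id[of G] unfolding vertex_orbits_def by blast

section \<open>Adding a vertex\<close>

lemma new_vertex_lgraphs: "G \<in> lgraphs k \<Longrightarrow> new_vertex G = Suc k"
  by (simp add: new_vertex_def lgraphs_card)

lemma verts_add_vertex: "G \<in> lgraphs k \<Longrightarrow> verts (add_vertex G W) = {1..Suc k}"
  by (auto simp: add_vertex_def new_vertex_lgraphs lgraphs_verts)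

lemma add_vertex_lgraphs:
  assumes "G \<in> lgraphs k" "W \<subseteq> verts G"
  shows "add_vertex G W \<in> lgraphs (Suc k)"
proof -
  have "e \<subseteq> {1..Suc k} \<and> card e = 2" if e: "e \<in> edges (add_vertex G W)" for e
  proof (cases "e \<in> edges G")
    case True
    then show ?thesis
      using assms(1) by (fastforce simp: lgraphs_def simple_graph_def)
  next
    case False
    then obtain w where "w \<in> W" "e = {w, Suc k}"
      using e assms(1) by (auto simp: add_vertex_def new_vertex_lgraphs)
    moreover have "w \<in> {1..k}"
      using \<open>w \<in> W\<close> assms lgraphs_verts by blast
    ultimately show ?thesis
      by auto
  qed
  then show ?thesis
    using verts_add_vertex[OF assms(1)] by (simp add: lgraphs_def simple_graph_def)
qed

lemma delete_new_vertex:
  assumes "G \<in> lgraphs k"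
  shows "delete_vertex (add_vertex G W) (Suc k) = G"
proof (rule sgraph.expand, intro conjI)
  show "verts (delete_vertex (add_vertex G W) (Suc k)) = verts G"
    using assms by (auto simp: verts_add_vertex lgraphs_verts)
  show "edges (delete_vertex (add_vertex G W) (Suc k)) = edges G"
    using assms simple_graph_edges[OF lgraphs_simple[OF assms]]
    by (fastforce simp: induced_def add_vertex_def new_vertex_lgraphs lgraphs_verts)
qed

text \<open>Extends an isomorphism of a card to the whole graph. The new neighbourhood is forced to
  be the image of the neighbours of \<open>v\<close>.\<close>

lemma graph_iso_add_vertex:
  assumes "H \<in> lgraphs (Suc k)" "G \<in> lgraphs k" "v \<in> verts H"
    and "graph_iso f (delete_vertex H v) G"
  shows "graph_iso (f(v := Suc k)) H (add_vertex G (f ` {u. {u, v} \<in> edges H}))"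
proof -
  let ?g = "f(v := Suc k)" and ?W = "f ` {u. {u, v} \<in> edges H}"
  have f: "bij_betw f (verts H - {v}) {1..k}"
    and E: "edges G = (\<lambda>e. f ` e) ` {e \<in> edges H. e \<subseteq> verts H - {v}}"
    using assms(2,4) by (auto simp: graph_iso_def induced_def lgraphs_verts)
  have "bij_betw ?g (verts H - {v}) {1..k}"
    using f by (subst bij_betw_cong[where g = f]) auto
  \<comment> \<open>\<open>v\<close> lies outside the domain and \<open>Suc k\<close> outside the
    range of the restricted bijection, so this pair can be added.\<close>
  then have "bij_betw ?g (insert v (verts H - {v})) (insert (?g v) {1..k})"
    by (subst notIn_Un_bij_betw3[of _ _ _ _, simplified, symmetric]) auto
  then have bij: "bij_betw ?g (verts H) {1..Suc k}"
    using assms(3) by (simp add: insert_absorb atLeastAtMostSuc_conv)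
  have old: "?g ` e = f ` e" if "e \<subseteq> verts H - {v}" for e
    using that by (auto intro!: image_cong)
  have new: "?g ` {u, v} = {f u, Suc k}" if "{u, v} \<in> edges H" for u
  proof -
    have "u \<noteq> v"
      using assms(1) that by (auto simp: lgraphs_def simple_graph_def)
    then show ?thesis by auto
  qed
  \<comment> \<open>An edge not contained in \<open>verts H - {v}\<close> contains \<open>v\<close>
    and, having two elements, is of the form \<open>{u, v}\<close>.\<close>
  have split: "edges H = {e \<in> edges H. e \<subseteq> verts H - {v}} \<union> {{u, v} |u. {u, v} \<in> edges H}"
  proof -
    have "\<exists>u. e = {u, v}" if "e \<in> edges H" "\<not> e \<subseteq> verts H - {v}" for e
    proof -
      have "e \<subseteq> verts H" "card e = 2"
        using assms(1) that(1) by (auto simp: lgraphs_def simple_graph_def)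
      then show ?thesis
        using that(2) by (auto simp: card_2_iff)
    qed
    then show ?thesis by blast
  qed
  have "(\<lambda>e. ?g ` e) ` edges H =
      (\<lambda>e. ?g ` e) ` {e \<in> edges H. e \<subseteq> verts H - {v}} \<union>
      (\<lambda>e. ?g ` e) ` {{u, v} |u. {u, v} \<in> edges H}"
    by (subst split) (rule image_Un)
  also have "(\<lambda>e. ?g ` e) ` {e \<in> edges H. e \<subseteq> verts H - {v}} = edges G"
    unfolding E by (rule image_cong) (auto simp only: old mem_Collect_eq)
  also have "(\<lambda>e. ?g ` e) ` {{u, v} |u. {u, v} \<in> edges H} =
      (\<lambda>u. ?g ` {u, v}) ` {u. {u, v} \<in> edges H}"
    by blast
  also have "\<dots> = (\<lambda>u. {f u, Suc k}) ` {u. {u, v} \<in> edges H}"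
    by (rule image_cong) (auto simp only: new mem_Collect_eq)
  also have "\<dots> = {{w, Suc k} |w. w \<in> ?W}"
    by blast
  finally have "(\<lambda>e. ?g ` e) ` edges H = edges (add_vertex G ?W)"
    using assms(2) by (simp add: add_vertex_def new_vertex_lgraphs)
  then show ?thesis
    using bij assms(2) by (simp add: graph_iso_def verts_add_vertex)
qed

lemma add_vertex_neighbours:
  assumes "G \<in> lgraphs k" "W \<subseteq> verts G"
  shows "{u. {u, Suc k} \<in> edges (add_vertex G W)} = W"
proof -
  have "{u, Suc k} \<notin> edges G" for u
    using simple_graph_edges[OF lgraphs_simple[OF assms(1)], of "{u, Suc k}"]
    by (auto simp: lgraphs_verts[OF assms(1)])
  moreover have "Suc k \<notin> W"
    using assms by (auto simp: lgraphs_verts)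
  ultimately show ?thesis
    using assms(1) by (auto simp: add_vertex_def new_vertex_lgraphs doubleton_eq_iff)
qed

text \<open>The case of \<open>graph_iso_add_vertex\<close> where the large graph is
  \<open>add_vertex G W\<close> itself. As \<open>\<phi>\<close> permutes \<open>{1..k}\<close>, it
  fixes \<open>Suc k\<close>, and the update at \<open>Suc k\<close> changes nothing. Members of one
  orbit thus give isomorphic children.\<close>

lemma Aut_graph_iso_add_vertex:
  assumes "G \<in> lgraphs k" "W \<subseteq> verts G" "\<phi> \<in> Aut G"
  shows "graph_iso \<phi> (add_vertex G W) (add_vertex G (\<phi> ` W))" and "\<phi> (Suc k) = Suc k"
proof -
  show fix_new: "\<phi> (Suc k) = Suc k"
    using assms(1,3) by (auto simp: Aut_def lgraphs_verts permutes_def)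
  have "graph_iso (\<phi>(Suc k := Suc k)) (add_vertex G W) (add_vertex G (\<phi> ` W))"
    using graph_iso_add_vertex[OF add_vertex_lgraphs[OF assms(1,2)] assms(1), of "Suc k" \<phi>,
        unfolded delete_new_vertex[OF assms(1)] add_vertex_neighbours[OF assms(1,2)]] assms(3)
    by (simp add: verts_add_vertex[OF assms(1)] Aut_iff_graph_iso)
  then show "graph_iso \<phi> (add_vertex G W) (add_vertex G (\<phi> ` W))"
    using fix_new by (metis fun_upd_triv)
qed

text \<open>Converse of the previous lemma: an isomorphism fixing the new vertex restricts to an
  automorphism of \<open>G\<close>, and it preserves adjacency to the new vertex, which encodes
  membership in \<open>W\<close> and \<open>W'\<close>.\<close>

lemma graph_iso_add_vertex_Aut:
  assumes "G \<in> lgraphs k" "W \<subseteq> verts G" "W' \<subseteq> verts G"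
    and "graph_iso f (add_vertex G W) (add_vertex G W')" "f (Suc k) = Suc k"
  obtains \<phi> where "\<phi> \<in> Aut G" "\<phi> ` W = W'"
proof -
  let ?H = "add_vertex G W" and ?H' = "add_vertex G W'"
  have H: "simple_graph ?H" "verts ?H = {1..Suc k}"
    using add_vertex_lgraphs[OF assms(1,2)] by (auto simp: lgraphs_def)
  have "graph_iso f G G"
    using graph_iso_delete_vertex[OF H(1) assms(4), of "Suc k",
        unfolded assms(5) delete_new_vertex[OF assms(1)]] H(2)
    by simp
  then obtain \<phi> where \<phi>: "\<phi> permutes verts G" "graph_iso \<phi> G G"
    and eq: "\<And>x. x \<in> verts G \<Longrightarrow> \<phi> x = f x"
    using graph_iso_extend_permutes[OF lgraphs_simple[OF assms(1)]] by blast
  have inj: "inj_on f {1..Suc k}" and E: "edges ?H' = (\<lambda>e. f ` e) ` edges ?H"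
    using assms(4) H(2) by (auto simp: graph_iso_def bij_betw_def)
  have sub: "e \<subseteq> {1..Suc k}" if "e \<in> edges ?H" for e
    using simple_graph_edges[OF H(1) that] H(2) by simp
  have "f u \<in> W' \<longleftrightarrow> u \<in> W" if "u \<in> {1..k}" for u
  proof -
    have "f u \<in> W' \<longleftrightarrow> f ` {u, Suc k} \<in> edges ?H'"
      using add_vertex_neighbours[OF assms(1,3)] assms(5) by auto
    also have "\<dots> \<longleftrightarrow> {u, Suc k} \<in> edges ?H"
    proof
      assume "f ` {u, Suc k} \<in> edges ?H'"
      then obtain e where e: "e \<in> edges ?H" "f ` {u, Suc k} = f ` e"
        unfolding E by blast
      have "{u, Suc k} = e"
        using inj_on_image_eq_iff[OF inj, of "{u, Suc k}" e] sub[OF e(1)] e(2) that by auto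
      with e(1) show "{u, Suc k} \<in> edges ?H" by simp
    qed (unfold E, rule imageI)
    also have "\<dots> \<longleftrightarrow> u \<in> W"
      using add_vertex_neighbours[OF assms(1,2)] by auto
    finally show ?thesis .
  qed
  then have iff: "\<phi> u \<in> W' \<longleftrightarrow> u \<in> W" if "u \<in> verts G" for u
    using that eq lgraphs_verts[OF assms(1)] by simp
  have "\<phi> ` W = W'"
  proof (intro equalityI subsetI)
    fix y assume y: "y \<in> W'"
    then obtain x where "x \<in> verts G" "y = \<phi> x"
      using assms(3) permutes_image[OF \<phi>(1)] by blast
    then show "y \<in> \<phi> ` W" using iff y by auto
  qed (use iff assms(2) in auto)
  then show ?thesis
    using that \<phi> by (simp add: Aut_iff_graph_iso)
qed

section \<open>Equivariant selection of vertices\<close>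

text \<open>The common consequence of (B) and (A') that one step of the algorithm uses: in part (b)
  it comes from (A') on the top level and from (B) below.\<close>

definition equivariant_on :: "(sgraph \<Rightarrow> nat set) \<Rightarrow> nat \<Rightarrow> bool" where
  "equivariant_on m k \<longleftrightarrow>
     (\<forall>H\<in>lgraphs k. \<forall>H'\<in>lgraphs k. \<forall>f. graph_iso f H H' \<longrightarrow> m H' = f ` m H)"

lemma equivariant_onD:
  "equivariant_on m k \<Longrightarrow> H \<in> lgraphs k \<Longrightarrow> H' \<in> lgraphs k \<Longrightarrow> graph_iso f H H' \<Longrightarrow> m H' = f ` m H"
  unfolding equivariant_on_def by blast

text \<open>(B) speaks of permutations only, so \<open>f\<close> is replaced by one agreeing with it
  on the vertices; \<open>m H \<subseteq> verts H\<close> makes the two images of \<open>m H\<close>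
  equal.\<close>

lemma cond_B_equivariant_on:
  assumes "\<forall>H\<in>lgraphs k. cond_B m H \<and> m H \<subseteq> verts H"
  shows "equivariant_on m k"
  unfolding equivariant_on_def
proof (intro ballI allI impI)
  fix H H' f assume H: "H \<in> lgraphs k" and H': "H' \<in> lgraphs k" and f: "graph_iso f H H'"
  have "verts H' = verts H"
    using H H' by (auto simp: lgraphs_def)
  then obtain \<phi> where \<phi>: "\<phi> permutes verts H" "graph_iso \<phi> H H'"
    and eq: "\<And>x. x \<in> verts H \<Longrightarrow> \<phi> x = f x"
    using graph_iso_extend_permutes[OF lgraphs_simple[OF H] f] by blast
  have "relabel \<phi> H = H'"
    using \<phi>(2) by (cases H') (auto simp: relabel_def graph_iso_def bij_betw_def)
  then have "m H' = \<phi> ` m H"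
    using assms H \<phi>(1) by (auto simp: cond_B_def)
  also have "\<dots> = f ` m H"
    using assms H eq by (intro image_cong) auto
  finally show "m H' = f ` m H" .
qed

section \<open>Isomorphism invariance of cards, decks and maximality\<close>

lemma simple_graph_delete_vertex: "simple_graph G \<Longrightarrow> simple_graph (delete_vertex G v)"
  by (simp add: simple_graph_induced)

lemma deck_card_graph_iso:
  assumes "simple_graph G" "graph_iso f G H" "v \<in> verts G"
  shows "deck_card H (f v) = deck_card G v"
proof -
  have "isomorphic (delete_vertex G v) (delete_vertex H (f v))"
    using graph_iso_delete_vertex[OF assms] isomorphic_iff_graph_iso by blast
  then show ?thesis
    using unlabelled_eq_iff[of "delete_vertex G v" "delete_vertex H (f v)"]
      simple_graph_delete_vertex assms(1) graph_iso_simple[OF assms(1,2)]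
    by (simp add: deck_card_def)
qed

lemma reduced_deck_graph_iso:
  assumes "simple_graph G" "graph_iso f G H"
  shows "reduced_deck H = reduced_deck G"
proof -
  have "verts H = f ` verts G"
    using assms(2) by (auto simp: graph_iso_def bij_betw_def)
  then show ?thesis
    using deck_card_graph_iso[OF assms] by (simp add: reduced_deck_def image_image)
qed

lemma maximal_card_graph_iso:
  assumes "simple_graph G" "graph_iso f G H" "v \<in> verts G"
  shows "maximal_card le H (f v) \<longleftrightarrow> maximal_card le G v"
  by (simp add: maximal_card_def deck_card_graph_iso[OF assms] reduced_deck_graph_iso[OF assms(1,2)])

text \<open>Automorphisms preserve maximality of cards, so an orbit contains only vertices with
  maximal cards or none at all, and the union in (A') collects every such vertex.\<close>

lemma cond_A'_eq:
  assumes "simple_graph H" "cond_A' le m H"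
  shows "m H = {v \<in> verts H. maximal_card le H v}"
proof -
  have aut: "\<phi> v \<in> verts H \<and> (maximal_card le H (\<phi> v) \<longleftrightarrow> maximal_card le H v)"
    if "\<phi> \<in> Aut H" "v \<in> verts H" for \<phi> v
    using that maximal_card_graph_iso[OF assms(1), of \<phi> H v]
    by (auto simp: Aut_iff_graph_iso permutes_in_image)
  have "v \<in> m H \<longleftrightarrow> v \<in> verts H \<and> maximal_card le H v" for v
  proof
    assume "v \<in> m H"
    then obtain A where A: "A \<in> vertex_orbits H" "\<forall>v\<in>A. maximal_card le H v" "v \<in> A"
      using assms(2) by (auto simp: cond_A'_def)
    then have "v \<in> verts H"
      using aut by (auto simp: vertex_orbits_def)
    with A show "v \<in> verts H \<and> maximal_card le H v" by blast
  next
    assume v: "v \<in> verts H \<and> maximal_card le H v"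
    let ?A = "{\<phi> v |\<phi>. \<phi> \<in> Aut H}"
    have "?A \<in> vertex_orbits H"
      using v by (auto simp: vertex_orbits_def)
    moreover have "\<forall>u\<in>?A. maximal_card le H u"
      using v aut by blast
    moreover have "v \<in> ?A"
      using Aut_id[of H] by (metis (mono_tags, lifting) id_apply mem_Collect_eq)
    ultimately show "v \<in> m H"
      using assms(2) unfolding cond_A'_def by blast
  qed
  then show ?thesis by blast
qed

lemma cond_A'_equivariant_on:
  assumes "\<forall>H\<in>lgraphs k. cond_A' le m H"
  shows "equivariant_on m k"
  unfolding equivariant_on_def
proof (intro ballI allI impI)
  fix H H' f assume H: "H \<in> lgraphs k" and H': "H' \<in> lgraphs k" and f: "graph_iso f H H'"
  have "verts H' = f ` verts H"
    using f by (auto simp: graph_iso_def bij_betw_def)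
  then show "m H' = f ` m H"
    using cond_A'_eq[OF lgraphs_simple[OF H], of le m] cond_A'_eq[OF lgraphs_simple[OF H'], of le m]
      assms H H' maximal_card_graph_iso[OF lgraphs_simple[OF H] f]
    by auto
qed

text \<open>Invariance of \<open>le\<close> transfers the relation from whichever representatives
  witness it to \<open>G\<close> and \<open>H\<close> themselves.\<close>

lemma unlabelled_le_unlabelled:
  assumes "iso_invariant_preorder le" "G \<in> labelled" "H \<in> labelled"
  shows "unlabelled_le le (unlabelled G) (unlabelled H) \<longleftrightarrow> (G, H) \<in> le"
proof
  assume "unlabelled_le le (unlabelled G) (unlabelled H)"
  then obtain X Y where XY: "X \<in> labelled" "isomorphic G X" "Y \<in> labelled" "isomorphic H Y" "(X, Y) \<in> le"
    by (auto simp: unlabelled_le_def unlabelled_def)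
  have "isomorphic X G" "isomorphic Y H"
    using XY(2,4) isomorphic_sym lgraphs_simple[OF labelled_lgraphs] assms(2,3) by auto
  then show "(G, H) \<in> le"
    using XY assms unfolding iso_invariant_preorder_def by blast
next
  assume "(G, H) \<in> le"
  then show "unlabelled_le le (unlabelled G) (unlabelled H)"
    using assms(2,3) isomorphic_refl by (auto simp: unlabelled_le_def unlabelled_def)
qed

text \<open>The vertex set is finite, so some vertex is maximal for the strict part of the preorder
  on cards. This makes the set of parents in (b) nonempty.\<close>

lemma maximal_card_exists:
  assumes "iso_invariant_preorder le" "simple_graph H" "verts H \<noteq> {}"
  shows "\<exists>v\<in>verts H. maximal_card le H v"
proof -
  \<comment> \<open>Labelled representatives \<open>L v\<close> of the cards turn comparisons of
    unlabelled cards into membership in \<open>le\<close>.\<close>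
  have "\<exists>X\<in>labelled. isomorphic (delete_vertex H v) X" for v
    using simple_graph_labelled_version[OF simple_graph_delete_vertex[OF assms(2), of v]]
    by (auto dest: lgraphs_labelled)
  then have "\<exists>L. \<forall>v. L v \<in> labelled \<and> isomorphic (delete_vertex H v) (L v)"
    by (intro choice) blast
  then obtain L where L: "\<And>v. L v \<in> labelled" "\<And>v. isomorphic (delete_vertex H v) (L v)"
    by blast
  have card_L: "deck_card H v = unlabelled (L v)" for v
    using unlabelled_eq_iff[OF simple_graph_delete_vertex[OF assms(2)]
        lgraphs_simple[OF labelled_lgraphs[OF L(1)]]] L(2)
    by (simp add: deck_card_def)
  have le_iff: "unlabelled_le le (deck_card H u) (deck_card H v) \<longleftrightarrow> (L u, L v) \<in> le" for u v
    by (simp add: card_L unlabelled_le_unlabelled[OF assms(1)] L(1))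
  have "trans le"
    using assms(1) by (auto simp: iso_invariant_preorder_def preorder_on_def)
  \<comment> \<open>The strict part is asymmetric and transitive even though \<open>le\<close> need
    not be antisymmetric.\<close>
  define R where "R u v \<longleftrightarrow> (L u, L v) \<in> le \<and> (L v, L u) \<notin> le" for u v
  have "\<exists>v\<in>verts H. \<forall>u\<in>verts H. u \<noteq> v \<longrightarrow> \<not> R v u"
  proof (rule Finite_Set.bex_max_element)
    show "finite (verts H)" using assms(2) by (simp add: simple_graph_def)
    show "asymp_on (verts H) R" by (auto simp: R_def intro!: asymp_onI)
    show "transp_on (verts H) R"
      using \<open>trans le\<close> unfolding R_def by (intro transp_onI) (meson transD)
  qed (rule assms(3))
  then obtain v where v: "v \<in> verts H" "\<forall>u\<in>verts H. u \<noteq> v \<longrightarrow> \<not> R v u"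
    by blast
  then have "maximal_card le H v"
    by (auto simp: maximal_card_def reduced_deck_def le_iff R_def)
  with v(1) show ?thesis by blast
qed

section \<open>One step of the algorithm\<close>

definition selected_card :: "(sgraph \<Rightarrow> nat set) \<Rightarrow> sgraph \<Rightarrow> sgraph \<Rightarrow> bool" where
  "selected_card m X G \<longleftrightarrow> (\<exists>v\<in>m X. isomorphic (delete_vertex X v) G)"

lemma hereditary_class_closed:
  "hereditary_class C \<Longrightarrow> G \<in> C \<Longrightarrow> H \<in> lgraphs k \<Longrightarrow> isomorphic G H \<Longrightarrow> H \<in> C"
  using lgraphs_labelled by (auto simp: hereditary_class_def)

lemma hereditary_class_lgraphs:
  assumes "hereditary_class C" "G \<in> C"
  shows "G \<in> lgraphs (card (verts G))" and "card (verts G) \<ge> 1"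
proof -
  have "G \<in> (\<Union>k\<in>{1..}. lgraphs k)"
    using assms unfolding hereditary_class_def by blast
  then obtain k where "k \<ge> 1" "G \<in> lgraphs k"
    by auto
  then show "G \<in> lgraphs (card (verts G))" and "card (verts G) \<ge> 1"
    using lgraphs_card[of G k] by auto
qed

text \<open>Holds for whatever choices \<open>W\<close> a run makes. An isomorphism from an accepted
  child onto \<open>X\<close> sends the new vertex into \<open>m X\<close>, and deleting it leaves
  \<open>G\<close>. Conversely, an isomorphism from the selected card to \<open>G\<close> is
  extended to \<open>X\<close> and adjusted to the subset the run picked.\<close>

lemma accepted_child_iff_selected_card:
  assumes C: "hereditary_class C" and G: "G \<in> lgraphs k" and X: "X \<in> C \<inter> lgraphs (Suc k)"
    and m: "equivariant_on m (Suc k)" "m X \<subseteq> verts X"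
    and W: "\<And>A. A \<in> subset_orbits G \<Longrightarrow> W A \<in> A"
  shows "(\<exists>A\<in>subset_orbits G. accepted C m G (W A) \<and> isomorphic (add_vertex G (W A)) X) \<longleftrightarrow>
    selected_card m X G"
proof
  assume "\<exists>A\<in>subset_orbits G. accepted C m G (W A) \<and> isomorphic (add_vertex G (W A)) X"
  then obtain A f where A: "A \<in> subset_orbits G" "accepted C m G (W A)"
    and f: "graph_iso f (add_vertex G (W A)) X"
    using isomorphic_iff_graph_iso by blast
  let ?H = "add_vertex G (W A)"
  have H: "?H \<in> lgraphs (Suc k)"
    using add_vertex_lgraphs[OF G subset_orbit_members[OF A(1) W[OF A(1)]]] .
  have "f (Suc k) \<in> m X"
    using A(2) equivariant_onD[OF m(1) H _ f] X by (simp add: accepted_def new_vertex_lgraphs[OF G])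
  moreover have "graph_iso f G (delete_vertex X (f (Suc k)))"
    using graph_iso_delete_vertex[OF lgraphs_simple[OF H] f, of "Suc k",
        unfolded delete_new_vertex[OF G]]
    by (simp add: verts_add_vertex[OF G])
  then have "isomorphic (delete_vertex X (f (Suc k))) G"
    using isomorphic_sym[OF lgraphs_simple[OF G]] isomorphic_iff_graph_iso by blast
  ultimately show "selected_card m X G"
    by (auto simp: selected_card_def)
next
  assume "selected_card m X G"
  then obtain v f where v: "v \<in> m X" and f: "graph_iso f (delete_vertex X v) G"
    by (auto simp: selected_card_def isomorphic_iff_graph_iso)
  have X': "X \<in> C" "X \<in> lgraphs (Suc k)" using X by auto
  define U where "U = f ` {u. {u, v} \<in> edges X}"
  have g: "graph_iso (f(v := Suc k)) X (add_vertex G U)"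
    using graph_iso_add_vertex[OF X'(2) G _ f] v m(2) by (auto simp: U_def)
  have "U \<subseteq> verts G"
  proof -
    have "u \<in> verts X - {v}" if "{u, v} \<in> edges X" for u
      using lgraphs_simple[OF X'(2)] that by (auto simp: simple_graph_def)
    then show ?thesis
      using f by (auto simp: U_def graph_iso_def bij_betw_def)
  qed
  \<comment> \<open>The run tries \<open>W A\<close> rather than \<open>U\<close>. An automorphism
    of \<open>G\<close> carrying \<open>U\<close> to \<open>W A\<close> is composed with the
    extension; it fixes \<open>Suc k\<close>, so \<open>v\<close> still goes to the new
    vertex.\<close>
  then obtain A where A: "A \<in> subset_orbits G" "U \<in> A"
    using subset_orbit_exists by blast
  then obtain \<phi> where \<phi>: "\<phi> \<in> Aut G" "W A = \<phi> ` U"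
    using subset_orbit_eq[OF lgraphs_simple[OF G] A] W[OF A(1)] by blast
  let ?H = "add_vertex G (W A)" and ?g = "\<phi> \<circ> f(v := Suc k)"
  have H: "?H \<in> lgraphs (Suc k)"
    using add_vertex_lgraphs[OF G subset_orbit_members[OF A(1) W[OF A(1)]]] .
  have iso: "graph_iso ?g X ?H"
    using graph_iso_comp[OF g] Aut_graph_iso_add_vertex(1)[OF G \<open>U \<subseteq> verts G\<close> \<phi>(1)] \<phi>(2) by simp
  have "?g v = Suc k"
    using Aut_graph_iso_add_vertex(2)[OF G \<open>U \<subseteq> verts G\<close> \<phi>(1)] by simp
  then have "Suc k \<in> m ?H"
    using equivariant_onD[OF m(1) X'(2) H iso] v by (metis imageI)
  moreover have "?H \<in> C"
    using hereditary_class_closed[OF C X'(1) H] iso isomorphic_iff_graph_iso by blast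
  moreover have "isomorphic ?H X"
    using isomorphic_sym[OF lgraphs_simple[OF X'(2)]] iso isomorphic_iff_graph_iso by blast
  ultimately show "\<exists>A\<in>subset_orbits G. accepted C m G (W A) \<and> isomorphic (add_vertex G (W A)) X"
    using A(1) by (auto simp: accepted_def new_vertex_lgraphs[OF G])
qed

text \<open>The orbit selected in the second child contains its new vertex and the image of the
  first one. An automorphism therefore corrects the isomorphism to fix the new vertex, and its
  restriction to \<open>G\<close> carries \<open>U\<close> to \<open>U'\<close>.\<close>

lemma accepted_children_isomorphic_imp_same_orbit:
  assumes G: "G \<in> lgraphs k" and m: "equivariant_on m (Suc k)" "\<forall>H\<in>lgraphs (Suc k). cond_A m H"
    and A: "A \<in> subset_orbits G" "U \<in> A" "accepted C m G U"
    and A': "A' \<in> subset_orbits G" "U' \<in> A'" "accepted C m G U'"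
    and "isomorphic (add_vertex G U) (add_vertex G U')"
  shows "A = A'"
proof -
  let ?H = "add_vertex G U" and ?H' = "add_vertex G U'"
  have U: "U \<subseteq> verts G" "U' \<subseteq> verts G"
    using A A' subset_orbit_members by blast+
  have H: "?H \<in> lgraphs (Suc k)" "?H' \<in> lgraphs (Suc k)"
    using add_vertex_lgraphs[OF G] U by auto
  obtain f where f: "graph_iso f ?H ?H'"
    using assms(10) isomorphic_iff_graph_iso by blast
  have "f (Suc k) \<in> m ?H'" "Suc k \<in> m ?H'"
    using A(3) A'(3) equivariant_onD[OF m(1) H f] by (auto simp: accepted_def new_vertex_lgraphs[OF G])
  moreover have "m ?H' \<in> vertex_orbits ?H'"
    using m(2) H(2) by (simp add: cond_A_def)
  ultimately obtain \<phi> where \<phi>: "\<phi> \<in> Aut ?H'" "\<phi> (f (Suc k)) = Suc k"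
    using vertex_orbit_transitive[OF lgraphs_simple[OF H(2)]] by blast
  have "graph_iso (\<phi> \<circ> f) ?H ?H'"
    using graph_iso_comp[OF f] \<phi>(1) by (auto simp: Aut_iff_graph_iso)
  moreover have "(\<phi> \<circ> f) (Suc k) = Suc k"
    using \<phi>(2) by simp
  ultimately obtain \<psi> where "\<psi> \<in> Aut G" "\<psi> ` U = U'"
    by (rule graph_iso_add_vertex_Aut[OF G U])
  then have "U' \<in> A"
    using subset_orbit_eq[OF lgraphs_simple[OF G] A(1,2)] by blast
  then show ?thesis
    using subset_orbit_eq[OF lgraphs_simple[OF G] A(1), of U']
      subset_orbit_eq[OF lgraphs_simple[OF G] A'(1,2)] by simp
qed

section \<open>Parents and ancestors up to isomorphism\<close>

definition parent :: "(sgraph \<Rightarrow> nat set) \<Rightarrow> sgraph \<Rightarrow> sgraph" where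
  "parent m X = (SOME G. G \<in> lgraphs (card (verts X) - 1) \<and> selected_card m X G)"

text \<open>An orbit is nonempty, so the choice in \<open>parent\<close> has a witness: a labelled
  version of a selected card.\<close>

lemma parent_selected_card:
  assumes X: "X \<in> lgraphs (Suc k)" and m: "cond_A m X" "m X \<subseteq> verts X"
  shows "parent m X \<in> lgraphs k" "selected_card m X (parent m X)"
proof -
  obtain v where v: "v \<in> m X"
    using m(1) vertex_orbit_nonempty by (auto simp: cond_A_def)
  have "card (verts (delete_vertex X v)) = k"
    using v m(2) X by (auto simp: lgraphs_verts[OF X])
  then obtain G where "G \<in> lgraphs k" "isomorphic (delete_vertex X v) G"
    using simple_graph_labelled_version[OF simple_graph_delete_vertex[OF lgraphs_simple[OF X]]]
    by metis
  then have "\<exists>G. G \<in> lgraphs (card (verts X) - 1) \<and> selected_card m X G"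
    using v by (auto simp: selected_card_def lgraphs_card[OF X])
  from someI_ex[OF this] show "parent m X \<in> lgraphs k" "selected_card m X (parent m X)"
    by (simp_all add: parent_def lgraphs_card[OF X])
qed

text \<open>The vertices of the single orbit \<open>m X\<close> have isomorphic cards, so the
  arbitrary choice in \<open>parent\<close> is harmless.\<close>

lemma selected_card_iff_parent:
  assumes X: "X \<in> lgraphs (Suc k)" and m: "cond_A m X" "m X \<subseteq> verts X" and G: "G \<in> lgraphs k"
  shows "selected_card m X G \<longleftrightarrow> isomorphic G (parent m X)"
proof -
  obtain v where v: "v \<in> m X" "isomorphic (delete_vertex X v) (parent m X)"
    using parent_selected_card(2)[OF X m] by (auto simp: selected_card_def)
  have sX: "simple_graph X" using lgraphs_simple[OF X] .
  show ?thesis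
  proof
    assume "selected_card m X G"
    then obtain u where u: "u \<in> m X" "isomorphic (delete_vertex X u) G"
      by (auto simp: selected_card_def)
    obtain \<phi> where \<phi>: "\<phi> \<in> Aut X" "\<phi> u = v"
      using vertex_orbit_transitive[OF sX _ u(1) v(1)] m(1) by (auto simp: cond_A_def)
    have "isomorphic (delete_vertex X u) (delete_vertex X v)"
      using graph_iso_delete_vertex[OF sX, of \<phi> X u] \<phi> u(1) m(2)
      by (auto simp: Aut_iff_graph_iso isomorphic_iff_graph_iso)
    then show "isomorphic G (parent m X)"
      using isomorphic_sym[OF simple_graph_delete_vertex[OF sX] u(2)] v(2) isomorphic_trans by blast
  next
    assume "isomorphic G (parent m X)"
    then show "selected_card m X G"
      using v(1) isomorphic_trans[OF v(2) isomorphic_sym[OF lgraphs_simple[OF G]]]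
      by (auto simp: selected_card_def)
  qed
qed

text \<open>\<open>k \<ge> 1\<close> keeps the remaining vertex set nonempty, as closure of
  \<open>C\<close> under induced subgraphs demands.\<close>

lemma selected_card_in_class:
  assumes C: "hereditary_class C" and X: "X \<in> C \<inter> lgraphs (Suc k)" and "k \<ge> 1" "m X \<subseteq> verts X"
    and G: "G \<in> lgraphs k" "selected_card m X G"
  shows "G \<in> C"
proof -
  obtain v where v: "v \<in> m X" "isomorphic (delete_vertex X v) G"
    using G(2) by (auto simp: selected_card_def)
  have "card (verts X - {v}) = k"
    using v assms(4) X lgraphs_card[of X "Suc k"] by auto
  then have "verts X - {v} \<noteq> {}"
    using \<open>k \<ge> 1\<close> by force
  then have "unlabelled (delete_vertex X v) \<subseteq> C"
    using C X unfolding hereditary_class_def by (meson Diff_subset Int_iff)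
  then show ?thesis
    using v(2) lgraphs_labelled[OF G(1)] by (auto simp: unlabelled_def)
qed

lemma ancestor_in_class:
  assumes C: "hereditary_class C" and X: "X \<in> C \<inter> lgraphs n"
    and m: "\<forall>k\<ge>1. k \<le> n \<longrightarrow> (\<forall>H\<in>lgraphs k. cond_A m H \<and> m H \<subseteq> verts H)"
    and "j < n"
  shows "(parent m ^^ j) X \<in> C \<inter> lgraphs (n - j)"
  using \<open>j < n\<close>
proof (induction j)
  case (Suc j)
  let ?Y = "(parent m ^^ j) X" and ?k = "n - Suc j"
  have Y: "?Y \<in> C \<inter> lgraphs (Suc ?k)"
    using Suc by (simp add: Suc_diff_Suc)
  then have mY: "cond_A m ?Y" "m ?Y \<subseteq> verts ?Y"
    using m[rule_format, of "Suc ?k" ?Y] Suc.prems by auto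
  show ?case
    using parent_selected_card[of ?Y ?k m] selected_card_in_class[OF C Y, of m] Y mY Suc.prems
    by auto
qed (use X in simp)

section \<open>Runs of the algorithm\<close>

lemma generate_exists:
  assumes "G \<in> lgraphs k" "k \<le> n"
  shows "\<exists>out. generate C m n p G out"
  using assms
proof (induction "n - k" arbitrary: k G p)
  case 0
  then have "card (verts G) = n"
    by (simp add: lgraphs_card)
  then show ?case
    using generate.emit by blast
next
  case (Suc d)
  \<comment> \<open>Any choice function serves, as orbits are nonempty.\<close>
  define W :: "nat set set \<Rightarrow> nat set" where "W A = (SOME U. U \<in> A)" for A
  have W: "W A \<in> A" if "A \<in> subset_orbits G" for A
    using subset_orbit_nonempty[OF that] by (auto simp: W_def some_in_eq)
  have "\<exists>out. generate C m n (Some G) (add_vertex G (W A)) out" if "A \<in> subset_orbits G" for A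
    using Suc.hyps(1)[OF _
        add_vertex_lgraphs[OF Suc.prems(1) subset_orbit_members[OF that W[OF that]]]] Suc.hyps(2)
    by simp
  then obtain out where out: "\<And>A. A \<in> subset_orbits G \<Longrightarrow>
      generate C m n (Some G) (add_vertex G (W A)) (out A)"
    by metis
  have "generate C m n p G
    (\<Sum>A\<in>subset_orbits G. if accepted C m G (W A) then out A else {#})"
    by (rule generate.loop[where W = W])
      (use W out Suc.hyps(2) lgraphs_card[OF Suc.prems(1)] in auto)
  then show ?case by blast
qed

lemma generate_output_in_class:
  assumes "hereditary_class C" "generate C m n p G out" "G \<in> C" "(q, H) \<in># out"
  shows "H \<in> C \<inter> lgraphs n"
  using assms(2-4)
proof (induction rule: generate.induct)
  case (emit G p)
  then show ?case
    using hereditary_class_lgraphs(1)[OF assms(1), of G] by auto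
next
  case (loop G W out p)
  then have "finite (subset_orbits G)"
    using finite_subset_orbits lgraphs_simple hereditary_class_lgraphs(1)[OF assms(1)] by blast
  then obtain A where A: "A \<in> subset_orbits G" "(q, H) \<in># out A"
    using loop.prems(2) by (auto simp: set_mset_sum)
  then have acc: "accepted C m G (W A)"
    using loop.hyps(4) by force
  then show ?case
    using loop.IH[OF A(1) acc] A(2) by (auto simp: accepted_def)
qed

lemma size_filter_mset_sum:
  "finite S \<Longrightarrow> size (filter_mset P (\<Sum>A\<in>S. f A)) = (\<Sum>A\<in>S. size (filter_mset P (f A)))"
  by (induction S rule: finite_induct) auto

text \<open>Following selected vertices upwards from \<open>X\<close> determines, up to isomorphism, a unique
  ancestor on every level. The calls whose subtree outputs a copy of \<open>X\<close> are those made for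
  that ancestor.\<close>

lemma generate_count:
  assumes C: "hereditary_class C" and X: "X \<in> C \<inter> lgraphs n"
    and m: "\<forall>k\<ge>1. k \<le> n \<longrightarrow> (\<forall>H\<in>lgraphs k. cond_A m H \<and> cond_B m H \<and> m H \<subseteq> verts H)"
    and "generate C m n p G out" "G \<in> C" "card (verts G) \<le> n"
  shows "size {#(q, H) \<in># out. isomorphic H X#} =
    (if isomorphic G ((parent m ^^ (n - card (verts G))) X) then 1 else 0)"
  using assms(4-6)
proof (induction rule: generate.induct)
  case (emit G p)
  then show ?case by simp
next
  case (loop G W out p)
  let ?k = "card (verts G)" and ?S = "subset_orbits G"
  have G: "G \<in> lgraphs ?k"
    using hereditary_class_lgraphs(1)[OF C loop.prems(1)] .
  have lt: "?k < n"
    using loop.hyps(1) loop.prems(2) by simp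
  \<comment> \<open>The ancestor of \<open>X\<close> with one vertex more than \<open>G\<close>; by
    induction, exactly the calls for its copies lead to a copy of \<open>X\<close>.\<close>
  let ?Y = "(parent m ^^ (n - Suc ?k)) X"
  have Y: "?Y \<in> C \<inter> lgraphs (Suc ?k)"
    using ancestor_in_class[OF C X, of m "n - Suc ?k"] m lt by simp
  have mY: "cond_A m ?Y" "m ?Y \<subseteq> verts ?Y" and mA: "\<forall>H\<in>lgraphs (Suc ?k). cond_A m H"
    using m[rule_format, of "Suc ?k"] Y lt by auto
  have equi: "equivariant_on m (Suc ?k)"
    by (rule cond_B_equivariant_on) (use m[rule_format, of "Suc ?k"] lt in auto)
  let ?good = "\<lambda>A. accepted C m G (W A) \<and> isomorphic (add_vertex G (W A)) ?Y"
  have each: "size {#(q, H) \<in># out A. isomorphic H X#} = (if ?good A then 1 else 0)"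
    if A: "A \<in> ?S" for A
  proof (cases "accepted C m G (W A)")
    case True
    have "card (verts (add_vertex G (W A))) = Suc ?k"
      using verts_add_vertex[OF G] by simp
    then show ?thesis
      using loop.IH[OF A True] True lt by (simp add: accepted_def)
  next
    case False
    then show ?thesis
      using loop.hyps(4)[OF A] by simp
  qed
  have fin: "finite ?S"
    using finite_subset_orbits[OF lgraphs_simple[OF G]] .
  \<comment> \<open>One more application of \<open>parent\<close> to \<open>?Y\<close> gives the
    ancestor on the level of \<open>G\<close>, and \<open>G\<close> has a suitable child iff it is a
    selected card of \<open>?Y\<close>.\<close>
  have ex_iff: "(\<exists>A\<in>?S. ?good A) \<longleftrightarrow> isomorphic G ((parent m ^^ (n - ?k)) X)"
  proof -
    have "n - ?k = Suc (n - Suc ?k)"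
      using lt by simp
    then have "(parent m ^^ (n - ?k)) X = parent m ?Y"
      by simp
    then show ?thesis
      using accepted_child_iff_selected_card[OF C G Y equi mY(2) loop.hyps(2)]
        selected_card_iff_parent[OF _ mY G] Y by simp
  qed
  have unique: "A = A'" if "A \<in> ?S" "A' \<in> ?S" "?good A" "?good A'" for A A'
  proof (rule accepted_children_isomorphic_imp_same_orbit[OF G equi mA])
    have "simple_graph (add_vertex G (W A'))"
      using lgraphs_simple[OF add_vertex_lgraphs[OF G
          subset_orbit_members[OF that(2) loop.hyps(2)[OF that(2)]]]] .
    then show "isomorphic (add_vertex G (W A)) (add_vertex G (W A'))"
      using that isomorphic_sym isomorphic_trans by blast
  qed (use that loop.hyps(2) in auto)
  have "size {#(q, H) \<in># (\<Sum>A\<in>?S. out A). isomorphic H X#} = (\<Sum>A\<in>?S. if ?good A then 1 else 0)"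
    using each by (simp add: size_filter_mset_sum[OF fin])
  \<comment> \<open>By \<open>unique\<close> at most one summand is 1.\<close>
  also have "\<dots> = (if \<exists>A\<in>?S. ?good A then 1 else 0)"
  proof (cases "\<exists>A\<in>?S. ?good A")
    case True
    then obtain A where A: "A \<in> ?S" "?good A" by blast
    then have "(\<Sum>A\<in>?S. if ?good A then 1 else 0) = (\<Sum>A'\<in>?S. if A' = A then 1 else (0::nat))"
      using unique by (intro sum.cong) auto
    then show ?thesis
      using True A(1) fin by simp
  next
    case False
    then have "(\<Sum>A\<in>?S. if ?good A then 1 else 0) = (0::nat)"
      by (intro sum.neutral ballI if_not_P) blast
    with False show ?thesis
      by (simp only: if_False)
  qed
  finally show ?case
    unfolding ex_iff .
qed

text \<open>Acceptance does not depend on the target size, so stopping the same run one level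
  earlier is again a run. Its outputs are the potential parents, and those of \<open>X\<close> are
  the ones that are selected cards of \<open>X\<close>.\<close>

lemma generate_truncate:
  assumes C: "hereditary_class C"
    and m: "equivariant_on m (Suc n)" "\<forall>H\<in>lgraphs (Suc n). m H \<subseteq> verts H"
    and "generate C m (Suc n) p G out" "G \<in> C" "card (verts G) \<le> n"
  shows "\<exists>out'. generate C m n p G out' \<and> (\<forall>X\<in>C \<inter> lgraphs (Suc n).
    output_parents out X = {P \<in> snd ` set_mset out'. selected_card m X P})"
  using assms(4-6)
proof (induction rule: generate.induct)
  case (emit G p)
  then show ?case by simp
next
  case (loop G W out p)
  let ?k = "card (verts G)" and ?S = "subset_orbits G"
  have G: "G \<in> lgraphs ?k"
    using hereditary_class_lgraphs(1)[OF C loop.prems(1)] .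
  have fin: "finite ?S"
    using finite_subset_orbits[OF lgraphs_simple[OF G]] .
  have card_add: "card (verts (add_vertex G (W A))) = Suc ?k" for A
    using verts_add_vertex[OF G] by simp
  have parents: "output_parents (\<Sum>A\<in>?S. out A) X =
      (\<Union>A\<in>{A \<in> ?S. accepted C m G (W A)}. output_parents (out A) X)" for X
    using loop.hyps(4) by (fastforce simp: output_parents_def set_mset_sum[OF fin])
  show ?case
  proof (cases "?k = n")
    case True
    \<comment> \<open>Here children already have \<open>Suc n\<close> vertices, so their calls only
      emit, while the truncated run emits \<open>G\<close>.\<close>
    have "out A = {#(Some G, add_vertex G (W A))#}" if "A \<in> ?S" "accepted C m G (W A)" for A
      using loop.hyps(3)[OF that] card_add[of A] True by (auto elim: generate.cases)
    then have "output_parents (\<Sum>A\<in>?S. out A) X = {P \<in> {G}. selected_card m X P}"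
      if X: "X \<in> C \<inter> lgraphs (Suc n)" for X
      using accepted_child_iff_selected_card[OF C G[unfolded True] X m(1) _ loop.hyps(2)] m(2) X
      unfolding parents by (auto simp: output_parents_def)
    moreover have "generate C m n p G {#(p, G)#}"
      using True by (rule generate.emit)
    ultimately show ?thesis
      by (intro exI[of _ "{#(p, G)#}"]) auto
  next
    case False
    then have lt: "?k < n"
      using loop.prems(2) by simp
    have "\<exists>out'. generate C m n (Some G) (add_vertex G (W A)) out' \<and> (\<forall>X\<in>C \<inter> lgraphs (Suc n).
        output_parents (out A) X = {P \<in> snd ` set_mset out'. selected_card m X P})"
      if "A \<in> ?S" "accepted C m G (W A)" for A
      using loop.IH[OF that] that(2) lt card_add[of A] by (auto simp: accepted_def)
    then obtain out' where out': "\<And>A. A \<in> ?S \<Longrightarrow> accepted C m G (W A) \<Longrightarrow>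
        generate C m n (Some G) (add_vertex G (W A)) (out' A) \<and> (\<forall>X\<in>C \<inter> lgraphs (Suc n).
        output_parents (out A) X = {P \<in> snd ` set_mset (out' A). selected_card m X P})"
      by metis
    let ?out' = "\<lambda>A. if accepted C m G (W A) then out' A else {#}"
    have "generate C m n p G (\<Sum>A\<in>?S. ?out' A)"
      by (rule generate.loop[where W = W]) (use False loop.hyps(2) out' in auto)
    moreover have "output_parents (\<Sum>A\<in>?S. out A) X =
        {P \<in> snd ` set_mset (\<Sum>A\<in>?S. ?out' A). selected_card m X P}"
      if X: "X \<in> C \<inter> lgraphs (Suc n)" for X
    proof -
      have "output_parents (\<Sum>A\<in>?S. out A) X =
          (\<Union>A\<in>{A \<in> ?S. accepted C m G (W A)}. {P \<in> snd ` set_mset (out' A). selected_card m X P})"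
        unfolding parents using out' X by (intro SUP_cong) auto
      also have "\<dots> = {P \<in> snd ` (\<Union>A\<in>{A \<in> ?S. accepted C m G (W A)}. set_mset (out' A)).
          selected_card m X P}"
        unfolding image_UN by blast
      also have "(\<Union>A\<in>{A \<in> ?S. accepted C m G (W A)}. set_mset (out' A)) =
          (\<Union>A\<in>?S. set_mset (?out' A))"
        by (auto split: if_splits)
      finally show ?thesis
        by (simp only: set_mset_sum[OF fin])
    qed
    ultimately show ?thesis by blast
  qed
qed

section \<open>The root of the search\<close>

lemma lgraphs_1: "lgraphs 1 = {K1}"
proof -
  have "G = K1" if "simple_graph G" "verts G = {1}" for G
  proof -
    have "e \<notin> edges G" for e
    proof
      assume "e \<in> edges G"
      then have "card e = 2" "e \<subseteq> {1}"
        using that by (auto simp: simple_graph_def)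
      then show False
        using card_mono[of "{1}" e] by simp
    qed
    then have "edges G = {}"
      by blast
    then show ?thesis
      using that(2) by (cases G) (simp add: K1_def)
  qed
  then show ?thesis
    by (auto simp: lgraphs_def K1_def simple_graph_def)
qed

lemma K1_in_hereditary_class:
  assumes "hereditary_class C"
  shows "K1 \<in> C"
proof -
  have "C \<noteq> {}"
    using assms unfolding hereditary_class_def by (rule conjunct1)
  then obtain G where G: "G \<in> C"
    by blast
  obtain k where k: "k \<ge> 1" "G \<in> lgraphs k"
    using hereditary_class_lgraphs[OF assms G] by blast
  have 1: "1 \<in> verts G" and simple: "simple_graph G"
    using lgraphs_verts[OF k(2)] lgraphs_simple[OF k(2)] k(1) by auto
  have "induced G {1} \<in> lgraphs 1"
    using simple_graph_induced[OF simple, of "{1}"] 1 by (simp add: lgraphs_def)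
  then have "induced G {1} = K1" "K1 \<in> labelled"
    using lgraphs_1 lgraphs_labelled[of K1 1] by blast+
  then have "K1 \<in> unlabelled (induced G {1})"
    using isomorphic_refl[of K1] by (simp add: unlabelled_def)
  moreover have "{1} \<subseteq> verts G"
    using 1 by simp
  then have "unlabelled (induced G {1}) \<subseteq> C"
    using assms G unfolding hereditary_class_def by (meson insert_not_empty)
  ultimately show ?thesis
    by blast
qed

text \<open>After \<open>n - 1\<close> steps the ancestor of \<open>X\<close> has one vertex and
  hence equals \<open>K1\<close>, so the indicator in \<open>generate_count\<close> is 1.\<close>

lemma generate_K1_count:
  assumes C: "hereditary_class C" and n: "n \<ge> 1" and X: "X \<in> C \<inter> lgraphs n"
    and m: "\<forall>k\<ge>1. k \<le> n \<longrightarrow> (\<forall>H\<in>lgraphs k. cond_A m H \<and> cond_B m H \<and> m H \<subseteq> verts H)"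
    and gen: "generate C m n p K1 out"
  shows "size {#(q, H) \<in># out. isomorphic H X#} = 1"
proof -
  have "(parent m ^^ (n - 1)) X \<in> lgraphs 1"
    using ancestor_in_class[OF C X, of m "n - 1"] m n by auto
  then have "(parent m ^^ (n - 1)) X = K1"
    using lgraphs_1 by simp
  moreover have "card (verts K1) = 1"
    by (simp add: K1_def)
  ultimately show ?thesis
    using generate_count[OF C X m gen K1_in_hereditary_class[OF C]] n isomorphic_refl[of K1] by simp
qed

text \<open>The right-hand side mentions \<open>X\<close> only through its reduced deck, so under
  (A') graphs with equal reduced decks have the same selected cards.\<close>

lemma selected_card_iff_reduced_deck:
  assumes X: "X \<in> lgraphs n" and A': "cond_A' le m X" and P: "simple_graph P"
  shows "selected_card m X P \<longleftrightarrow> unlabelled P \<in> reduced_deck X \<and>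
    (\<forall>c\<in>reduced_deck X. unlabelled_le le (unlabelled P) c \<longrightarrow> unlabelled_le le c (unlabelled P))"
proof -
  have sX: "simple_graph X" using lgraphs_simple[OF X] .
  have "isomorphic (delete_vertex X v) P \<longleftrightarrow> deck_card X v = unlabelled P" for v
    using unlabelled_eq_iff[OF simple_graph_delete_vertex[OF sX] P] by (simp add: deck_card_def)
  then show ?thesis
    unfolding selected_card_def cond_A'_eq[OF sX A'] maximal_card_def reduced_deck_def by auto
qed

theorem theorem1:
  fixes C :: "sgraph set" and n :: nat and le :: "sgraph rel" and m :: "sgraph \<Rightarrow> nat set"
  assumes "hereditary_class C"
    and "n \<ge> 1"
    and "iso_invariant_preorder le"
    and "\<forall>k\<ge>1. \<forall>H\<in>lgraphs k. m H \<subseteq> verts H"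
  shows
    "((\<forall>k\<ge>1. \<forall>H\<in>lgraphs k. cond_A m H \<and> cond_B m H) \<longrightarrow>
        (\<exists>out. generate C m n None K1 out) \<and>
        (\<forall>out. generate C m n None K1 out \<longrightarrow>
           (\<forall>(p, H)\<in>#out. H \<in> C \<inter> lgraphs n) \<and>
           (\<forall>G\<in>C \<inter> lgraphs n. size {#(p, H) \<in># out. isomorphic H G#} = 1)))
     \<and>
     ((\<forall>k. 1 \<le> k \<and> k < n \<longrightarrow> (\<forall>H\<in>lgraphs k. cond_A m H \<and> cond_B m H)) \<longrightarrow>
        (\<forall>H\<in>lgraphs n. cond_A' le m H) \<longrightarrow>
        (\<forall>G1\<in>C \<inter> lgraphs n. \<forall>G2\<in>C \<inter> lgraphs n.
           \<not> isomorphic G1 G2 \<longrightarrow> reduced_deck G1 = reduced_deck G2 \<longrightarrow>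
           (\<exists>out. generate C m n None K1 out) \<and>
           (\<forall>out. generate C m n None K1 out \<longrightarrow>
              output_parents out G1 = output_parents out G2 \<and> output_parents out G1 \<noteq> {})))"
proof -
  note C = assms(1) and mV = assms(4)
  have K1: "K1 \<in> C" "K1 \<in> lgraphs 1" "card (verts K1) = 1"
    using K1_in_hereditary_class[OF C] lgraphs_1 by (auto simp: K1_def)
  have ex: "\<exists>out. generate C m n None K1 out"
    using generate_exists[OF K1(2) assms(2)] .
  show ?thesis
  proof (intro conjI impI ballI allI ex)
    fix out assume "\<forall>k\<ge>1. \<forall>H\<in>lgraphs k. cond_A m H \<and> cond_B m H"
      and gen: "generate C m n None K1 out"
    then have m: "\<forall>k\<ge>1. k \<le> n \<longrightarrow> (\<forall>H\<in>lgraphs k. cond_A m H \<and> cond_B m H \<and> m H \<subseteq> verts H)"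
      using mV by auto
    show "case x of (p, H) \<Rightarrow> H \<in> C \<inter> lgraphs n" if "x \<in># out" for x
      using generate_output_in_class[OF C gen K1(1)] that by (cases x) blast
    show "size {#(p, H) \<in># out. isomorphic H G#} = 1" if "G \<in> C \<inter> lgraphs n" for G
      using generate_K1_count[OF C assms(2) that m gen] .
  next
    fix G1 G2 out
    assume AB: "\<forall>k. 1 \<le> k \<and> k < n \<longrightarrow> (\<forall>H\<in>lgraphs k. cond_A m H \<and> cond_B m H)"
      and A': "\<forall>H\<in>lgraphs n. cond_A' le m H"
      and G1: "G1 \<in> C \<inter> lgraphs n" and G2: "G2 \<in> C \<inter> lgraphs n"
      and "\<not> isomorphic G1 G2" and deck: "reduced_deck G1 = reduced_deck G2"
      and gen: "generate C m n None K1 out"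
    \<comment> \<open>\<open>K1\<close> is the only labelled graph on one vertex, so a
      non-isomorphic pair forces a level \<open>k = n - 1\<close> of at least 1, where (A) and (B)
      are available.\<close>
    have "n \<noteq> 1"
      using \<open>\<not> isomorphic G1 G2\<close> G1 G2 lgraphs_1 isomorphic_refl by auto
    then obtain k where k: "n = Suc k" "k \<ge> 1"
      using assms(2) by (cases n) auto
    have m: "\<forall>j\<ge>1. j \<le> k \<longrightarrow> (\<forall>H\<in>lgraphs j. cond_A m H \<and> cond_B m H \<and> m H \<subseteq> verts H)"
      using AB mV k by auto
    have "\<exists>out'. generate C m k None K1 out' \<and> (\<forall>X\<in>C \<inter> lgraphs (Suc k).
        output_parents out X = {P \<in> snd ` set_mset out'. selected_card m X P})"
    proof (rule generate_truncate[OF C])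
      show "equivariant_on m (Suc k)"
        using cond_A'_equivariant_on A' k(1) by blast
    qed (use gen K1 k mV in auto)
    then obtain out' where gen': "generate C m k None K1 out'"
      and parents: "\<And>X. X \<in> C \<inter> lgraphs n \<Longrightarrow>
        output_parents out X = {P \<in> snd ` set_mset out'. selected_card m X P}"
      using k(1) by blast
    have simple: "simple_graph P" if "P \<in> snd ` set_mset out'" for P
      using generate_output_in_class[OF C gen' K1(1)] lgraphs_simple that by fastforce
    have "selected_card m G1 P \<longleftrightarrow> selected_card m G2 P" if "P \<in> snd ` set_mset out'" for P
      using selected_card_iff_reduced_deck[OF _ _ simple[OF that], of G1 n le m]
        selected_card_iff_reduced_deck[OF _ _ simple[OF that], of G2 n le m] G1 G2 A' deck by simp
    then show "output_parents out G1 = output_parents out G2"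
      using parents[OF G1] parents[OF G2] by auto
    have sG1: "simple_graph G1" "verts G1 = {1..n}"
      using G1 by (auto simp: lgraphs_def)
    \<comment> \<open>A vertex with maximal card lies in \<open>m G1\<close> by (A'); a labelled
      version \<open>P\<close> of its card is a candidate parent.\<close>
    obtain v where v: "v \<in> m G1" "v \<in> verts G1"
      using maximal_card_exists[OF assms(3) sG1(1)] cond_A'_eq[OF sG1(1), of le m] A' G1 sG1(2) k
      by auto
    have "card (verts (delete_vertex G1 v)) = k"
      using v(2) sG1(2) k by auto
    then obtain P where P: "P \<in> lgraphs k" "isomorphic (delete_vertex G1 v) P"
      using simple_graph_labelled_version[OF simple_graph_delete_vertex[OF sG1(1)]] by metis
    have "P \<in> C"
      using selected_card_in_class[OF C G1[unfolded k(1)] k(2) _ P(1), of m] v P(2) mV G1 k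
      by (auto simp: selected_card_def)
    \<comment> \<open>Counting on level \<open>k\<close> yields an output \<open>H\<close>
      isomorphic to \<open>P\<close>, which is then a logged parent of a copy of
      \<open>G1\<close>.\<close>
    then have "size {#(q, H) \<in># out'. isomorphic H P#} = 1"
      using generate_K1_count[OF C k(2) _ m gen'] P(1) by simp
    then have "{#(q, H) \<in># out'. isomorphic H P#} \<noteq> {#}"
      by force
    then obtain q H where H: "(q, H) \<in># out'" "isomorphic H P"
      by (auto elim!: multiset_nonemptyE)
    then have "H \<in> snd ` set_mset out'"
      by force
    moreover have "selected_card m G1 H"
      using v(1) P(2) isomorphic_sym[OF simple[OF calculation] H(2)] isomorphic_trans
      by (auto simp: selected_card_def)
    ultimately show "output_parents out G1 \<noteq> {}"
      using parents[OF G1] by blast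
  qed
qed

end
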